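(* Let $|\Omega_1|,\dots,|\Omega_m|>0$, $\alpha\in\mathbb R$, $\mathbf b\in\mathbb R^m$, and let $\mathbf A=(a_{i,j})\in\mathbb R^{m\times m}$ satisfy $\sum_{i=1}^m|\Omega_i|(\mathbf A\mathbf y)_i=0$ for all $\mathbf y\in\mathbb R^m$. Write $\mathbf A=\mathbf D+\mathbf L+\mathbf U$ with $\mathbf D,\mathbf L,\mathbf U$ the diagonal, strictly lower and strictly upper triangular parts, and assume $\mathbf I-\alpha\mathbf D$ is invertible. The iterates of the Jacobi method $$\mathbf u^{(k+1)}=\alpha(\mathbf I-\alpha\mathbf D)^{-1}(\mathbf L+\mathbf U)\mathbf u^{(k)}+(\mathbf I-\alpha\mathbf D)^{-1}\mathbf b$$ for $(\mathbf I-\alpha\mathbf A)\mathbf u=\mathbf b$ satisfy $$\sum_{i=1}^m|\Omega_i|u_i^{(k+1)}=\sum_{i=1}^m|\Omega_i|b_i+\alpha\sum_{i=1}^m|\Omega_i|a_{i,i}\left(u_i^{(k+1)}-u_i^{(k)}\right).$$ The Jacobi method is not globally conservative in general: there exist such $m$, $|\Omega_i|$, $\alpha$, $\mathbf A$, $\mathbf b$ and an initial guess $\mathbf u^{(0)}$ with $\sum_i|\Omega_i|u_i^{(0)}=\sum_i|\Omega_i|b_i$ for which $\sum_i|\Omega_i|u_i^{(1)}\ne\sum_i|\Omega_i|b_i$. However, if $\mathbf D=a\mathbf I$ for a scalar $a$ with $\alpha a\ne1$ and $\sum_i|\Omega_i|u_i^{(0)}=\sum_i|\Omega_i|b_i$,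 then $\sum_i|\Omega_i|u_i^{(k+1)}=\sum_i|\Omega_i|b_i$ for all $k\ge0$.
   Context: The mass of a vector $\mathbf y\in\mathbb R^m$ is $\sum_{i=1}^m|\Omega_i|y_i$, where $|\Omega_i|$ is the volume of the $i$th cell. An iterative method for $(\mathbf I-\alpha\mathbf A)\mathbf u=\mathbf b$ is globally conservative if all iterates $\mathbf u^{(k+1)}$, $k\ge0$, have the same mass as $\mathbf b$, when the initial guess $\mathbf u^{(0)}$ has the mass of $\mathbf b$. *)

theory Defs
  imports Complex_Main "Jordan_Normal_Form.Gauss_Jordan_Elimination"
begin

text \<open>
  Cells and components are indexed by 0, ..., m - 1 instead of 1, ..., m;
  \<open>vol i\<close> is the volume of cell i.
\<close>

definition mass :: "(nat \<Rightarrow> real) \<Rightarrow> real vec \<Rightarrow> real" where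
  "mass vol y = (\<Sum>i<dim_vec y. vol i * y $ i)"

definition diag_part :: "real mat \<Rightarrow> real mat" where
  "diag_part A = mat (dim_row A) (dim_col A) (\<lambda>(i, j). if i = j then A $$ (i, j) else 0)"

definition lower_part :: "real mat \<Rightarrow> real mat" where
  "lower_part A = mat (dim_row A) (dim_col A) (\<lambda>(i, j). if j < i then A $$ (i, j) else 0)"

definition upper_part :: "real mat \<Rightarrow> real mat" where
  "upper_part A = mat (dim_row A) (dim_col A) (\<lambda>(i, j). if i < j then A $$ (i, j) else 0)"

lemma diag_lower_upper_carrier [simp]:
  assumes "A \<in> carrier_mat n m"
  shows "diag_part A \<in> carrier_mat n m" "lower_part A \<in> carrier_mat n m"
    "upper_part A \<in> carrier_mat n m"
  using assms by (auto simp: diag_part_def lower_part_def upper_part_def)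

lemma diag_lower_upper_decomp: "A = diag_part A + lower_part A + upper_part A"
  by (rule eq_matI) (auto simp: diag_part_def lower_part_def upper_part_def)

text \<open>The matrix inverse; unspecified when the argument is not invertible.\<close>

definition mat_inv :: "real mat \<Rightarrow> real mat" where
  "mat_inv M = the (mat_inverse M)"

lemma mat_inv:
  assumes M: "M \<in> carrier_mat n n" and inv: "invertible_mat M"
  shows "mat_inv M \<in> carrier_mat n n" "M * mat_inv M = 1\<^sub>m n" "mat_inv M * M = 1\<^sub>m n"
proof -
  from inv obtain B where B: "M * B = 1\<^sub>m n" "B * M = 1\<^sub>m (dim_row B)"
    using M by (auto simp: invertible_mat_def inverts_mat_def)
  have "dim_col B = n" using arg_cong[OF B(1), of dim_col] by simp
  moreover have "dim_row B = n" using arg_cong[OF B(2), of dim_col] M by simp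
  ultimately have "B \<in> carrier_mat n n" by auto
  with B M have "M \<in> Units (ring_mat TYPE(real) n ())"
    by (auto simp: Units_def ring_mat_simps intro!: bexI[of _ B])
  then obtain C where "mat_inverse M = Some C"
    using mat_inverse(1)[OF M, where b="()"] by (cases "mat_inverse M") auto
  with mat_inverse(2)[OF M this]
  show "mat_inv M \<in> carrier_mat n n" "M * mat_inv M = 1\<^sub>m n" "mat_inv M * M = 1\<^sub>m n"
    by (auto simp: mat_inv_def)
qed

primrec jacobi :: "real \<Rightarrow> real mat \<Rightarrow> real vec \<Rightarrow> real vec \<Rightarrow> nat \<Rightarrow> real vec" where
  "jacobi \<alpha> A b u0 0 = u0"
| "jacobi \<alpha> A b u0 (Suc k) =
     (let N = mat_inv (1\<^sub>m (dim_row A) - \<alpha> \<cdot>\<^sub>m diag_part A)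
      in (\<alpha> \<cdot>\<^sub>m (N * (lower_part A + upper_part A))) *\<^sub>v jacobi \<alpha> A b u0 k + N *\<^sub>v b)"

text \<open>
  An iterative method for a system with right-hand side b is represented by the map
  taking an initial guess to its sequence of iterates.
\<close>

definition globally_conservative ::
  "(nat \<Rightarrow> real) \<Rightarrow> real vec \<Rightarrow> (real vec \<Rightarrow> nat \<Rightarrow> real vec) \<Rightarrow> bool" where
  "globally_conservative vol b u \<longleftrightarrow>
     (\<forall>u0 \<in> carrier_vec (dim_vec b). mass vol u0 = mass vol b \<longrightarrow>
        (\<forall>k. mass vol (u u0 (Suc k)) = mass vol b))"

definition conservative_system ::
  "nat \<Rightarrow> (nat \<Rightarrow> real) \<Rightarrow> real mat \<Rightarrow> real vec \<Rightarrow> bool" where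
  "conservative_system m vol A b \<longleftrightarrow>
     (\<forall>i<m. vol i > 0) \<and> A \<in> carrier_mat m m \<and> b \<in> carrier_vec m \<and>
     (\<forall>y \<in> carrier_vec m. (\<Sum>i<m. vol i * (A *\<^sub>v y) $ i) = 0)"

end

theory Submission
  imports Defs
begin

text \<open>
  Multiplying the update by \<open>I - \<alpha> D\<close> gives \<open>(I - \<alpha> D) u' = \<alpha> (L + U) u + b\<close>, and replacing
  \<open>L + U\<close> by \<open>A - D\<close> turns this into \<open>u' = b + \<alpha> A u + \<alpha> D (u' - u)\<close>
  (lemma \<open>jacobi_Suc_index\<close>). The term \<open>A u\<close> carries no mass, so the mass defect of \<open>u'\<close> is
  exactly that of \<open>\<alpha> D (u' - u)\<close> (lemma \<open>jacobi_mass_defect\<close>).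

  If \<open>D = a I\<close>, the defect is \<open>\<alpha> a\<close> times the change of mass in one step, so a step starting
  with the mass of \<open>b\<close> has a defect \<open>\<delta>\<close> with \<open>\<delta> = \<alpha> a \<delta>\<close>, which forces \<open>\<delta> = 0\<close>. If \<open>D\<close> is not
  scalar, the defect weighs the changes in different cells differently, and two cells already
  suffice for a nonzero defect: an upwind flux out of the first cell into the second, for which
  \<open>D = diag (-1, 0)\<close>.
\<close>

lemma smult_mat_mult_vec:
  fixes c :: "'a :: comm_ring_1"
  assumes "B \<in> carrier_mat n m" and "u \<in> carrier_vec m"
  shows "(c \<cdot>\<^sub>m B) *\<^sub>v u = c \<cdot>\<^sub>v (B *\<^sub>v u)"
  using assms by (intro eq_vecI) auto

lemma diag_part_mult_vec_index:
  assumes A: "A \<in> carrier_mat m m" and u: "u \<in> carrier_vec m" and i: "i < m"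
  shows "(diag_part A *\<^sub>v u) $ i = A $$ (i, i) * u $ i"
proof -
  have "(diag_part A *\<^sub>v u) $ i = (\<Sum>j<m. diag_part A $$ (i, j) * u $ j)"
    using diag_lower_upper_carrier(1)[OF A] u i
    by (auto simp: scalar_prod_def lessThan_atLeast0 intro!: sum.cong)
  also have "\<dots> = (\<Sum>j<m. if i = j then A $$ (i, i) * u $ i else 0)"
    using A i by (intro sum.cong) (auto simp: diag_part_def)
  also have "\<dots> = A $$ (i, i) * u $ i"
    using i by simp
  finally show ?thesis .
qed

lemma invertible_one_minus_diag_part:
  assumes A: "A \<in> carrier_mat m m" and nz: "\<And>i. i < m \<Longrightarrow> \<alpha> * A $$ (i, i) \<noteq> 1"
  shows "invertible_mat (1\<^sub>m m - \<alpha> \<cdot>\<^sub>m diag_part A)" (is "invertible_mat ?M")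
proof -
  define B where "B = mat m m (\<lambda>(i, j). if i = j then 1 / (1 - \<alpha> * A $$ (i, i)) else 0)"
  have M: "?M = mat m m (\<lambda>(i, j). if i = j then 1 - \<alpha> * A $$ (i, i) else 0)"
    using A by (intro eq_matI) (auto simp: diag_part_def)
  have diag_mult: "mat m m (\<lambda>(i, j). if i = j then f i else 0) *
      mat m m (\<lambda>(i, j). if i = j then g i else 0) = 1\<^sub>m m"
    if "\<And>i. i < m \<Longrightarrow> f i * g i = 1" for f g :: "nat \<Rightarrow> real"
  proof (rule eq_matI, goal_cases)
    case (1 i j)
    then show ?case using that
      by (auto simp: scalar_prod_def if_distrib [of "\<lambda>x. x * _"] cong: if_cong)
  qed auto
  have "?M * B = 1\<^sub>m m" "B * ?M = 1\<^sub>m m"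
    unfolding M B_def by (rule diag_mult; use nz in force)+
  moreover have "dim_row B = m" by (simp add: B_def)
  ultimately show ?thesis
    using A by (auto simp: invertible_mat_def inverts_mat_def diag_part_def intro!: exI[of _ B])
qed

lemma jacobi_carrier:
  assumes A: "A \<in> carrier_mat m m" and b: "b \<in> carrier_vec m" and u0: "u0 \<in> carrier_vec m"
    and inv: "invertible_mat (1\<^sub>m m - \<alpha> \<cdot>\<^sub>m diag_part A)"
  shows "jacobi \<alpha> A b u0 k \<in> carrier_vec m"
proof (induction k)
  case 0
  show ?case using u0 by simp
next
  case (Suc k)
  define N where "N = mat_inv (1\<^sub>m m - \<alpha> \<cdot>\<^sub>m diag_part A)"
  have "1\<^sub>m m - \<alpha> \<cdot>\<^sub>m diag_part A \<in> carrier_mat m m"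
    using A by (auto simp: diag_part_def)
  from mat_inv(1)[OF this inv] have "N \<in> carrier_mat m m"
    by (simp add: N_def)
  then show ?case using A by (intro carrier_vecI) (simp add: Let_def flip: N_def)
qed

lemma jacobi_Suc_index:
  assumes A: "A \<in> carrier_mat m m" and b: "b \<in> carrier_vec m" and u0: "u0 \<in> carrier_vec m"
    and inv: "invertible_mat (1\<^sub>m m - \<alpha> \<cdot>\<^sub>m diag_part A)" and i: "i < m"
  shows "jacobi \<alpha> A b u0 (Suc k) $ i =
    b $ i + \<alpha> * (A *\<^sub>v jacobi \<alpha> A b u0 k) $ i +
    \<alpha> * (A $$ (i, i) * (jacobi \<alpha> A b u0 (Suc k) $ i - jacobi \<alpha> A b u0 k $ i))"
proof -
  define u u' where "u = jacobi \<alpha> A b u0 k" and "u' = jacobi \<alpha> A b u0 (Suc k)"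
  define D S where "D = diag_part A" and "S = lower_part A + upper_part A"
  define M where "M = 1\<^sub>m m - \<alpha> \<cdot>\<^sub>m D"
  define N where "N = mat_inv M"
  have u: "u \<in> carrier_vec m" and u': "u' \<in> carrier_vec m"
    unfolding u_def u'_def by (rule jacobi_carrier[OF A b u0 inv])+
  have D: "D \<in> carrier_mat m m" and S: "S \<in> carrier_mat m m"
    using A by (auto simp: D_def S_def)
  have M: "M \<in> carrier_mat m m"
    using D by (auto simp: M_def)
  have N: "N \<in> carrier_mat m m" and MN: "M * N = 1\<^sub>m m"
    using mat_inv[OF M] inv by (auto simp: N_def M_def D_def)
  have Su: "S *\<^sub>v u \<in> carrier_vec m"
    using S u by simp
  have "u' = (\<alpha> \<cdot>\<^sub>m (N * S)) *\<^sub>v u + N *\<^sub>v b"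
    using A by (simp add: u'_def u_def N_def M_def D_def S_def Let_def)
  also have "(\<alpha> \<cdot>\<^sub>m (N * S)) *\<^sub>v u = N *\<^sub>v (\<alpha> \<cdot>\<^sub>v (S *\<^sub>v u))"
    using N S u Su by (simp add: smult_mat_mult_vec[of _ m m] mult_mat_vec assoc_mult_mat_vec)
  also have "\<dots> + N *\<^sub>v b = N *\<^sub>v (\<alpha> \<cdot>\<^sub>v (S *\<^sub>v u) + b)"
    using N Su b by (simp add: mult_add_distrib_mat_vec)
  finally have "M *\<^sub>v u' = (M * N) *\<^sub>v (\<alpha> \<cdot>\<^sub>v (S *\<^sub>v u) + b)"
    using M N Su b by (simp add: assoc_mult_mat_vec)
  also have "\<dots> = \<alpha> \<cdot>\<^sub>v (S *\<^sub>v u) + b"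
    using MN Su b by simp
  finally have "(M *\<^sub>v u') $ i = \<alpha> * (S *\<^sub>v u) $ i + b $ i"
    using i Su S b by simp
  moreover have "(M *\<^sub>v u') $ i = u' $ i - \<alpha> * (A $$ (i, i) * u' $ i)"
    unfolding M_def using D u' i diag_part_mult_vec_index[OF A u' i]
    by (simp add: minus_mult_distrib_mat_vec[of _ m m] smult_mat_mult_vec[of _ m m] D_def)
  moreover have "(A *\<^sub>v u) $ i = A $$ (i, i) * u $ i + (S *\<^sub>v u) $ i"
  proof -
    have "A = D + S"
      using A diag_lower_upper_decomp[of A] by (simp add: D_def S_def assoc_add_mat[of _ m m])
    then have "A *\<^sub>v u = D *\<^sub>v u + S *\<^sub>v u"
      using D S u by (simp add: add_mult_distrib_mat_vec)
    then show ?thesis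
      using i S D diag_part_mult_vec_index[OF A u i] by (simp add: D_def)
  qed
  ultimately have "u' $ i = b $ i + \<alpha> * (A *\<^sub>v u) $ i + \<alpha> * (A $$ (i, i) * (u' $ i - u $ i))"
    by (simp add: algebra_simps)
  then show ?thesis by (simp only: u_def u'_def)
qed

lemma jacobi_mass_defect:
  assumes sys: "conservative_system m vol A b"
    and inv: "invertible_mat (1\<^sub>m m - \<alpha> \<cdot>\<^sub>m diag_part A)" and u0: "u0 \<in> carrier_vec m"
  shows "(\<Sum>i<m. vol i * jacobi \<alpha> A b u0 (Suc k) $ i) =
    (\<Sum>i<m. vol i * b $ i) +
    \<alpha> * (\<Sum>i<m. vol i * A $$ (i, i) *
           (jacobi \<alpha> A b u0 (Suc k) $ i - jacobi \<alpha> A b u0 k $ i))"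
proof -
  have A: "A \<in> carrier_mat m m" and b: "b \<in> carrier_vec m"
    using sys by (auto simp: conservative_system_def)
  define u u' where "u = jacobi \<alpha> A b u0 k" and "u' = jacobi \<alpha> A b u0 (Suc k)"
  have "(\<Sum>i<m. vol i * u' $ i) =
      (\<Sum>i<m. vol i * b $ i + \<alpha> * (vol i * (A *\<^sub>v u) $ i) +
         \<alpha> * (vol i * A $$ (i, i) * (u' $ i - u $ i)))"
  proof (rule sum.cong)
    fix i assume "i \<in> {..<m}"
    then have i: "i < m" by simp
    have "vol i * u' $ i = vol i * (b $ i + \<alpha> * (A *\<^sub>v u) $ i + \<alpha> * (A $$ (i, i) * (u' $ i - u $ i)))"
      using jacobi_Suc_index[OF A b u0 inv i, of k, folded u_def u'_def] by (rule arg_cong)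
    then show "vol i * u' $ i = vol i * b $ i + \<alpha> * (vol i * (A *\<^sub>v u) $ i) +
        \<alpha> * (vol i * A $$ (i, i) * (u' $ i - u $ i))"
      by (simp add: algebra_simps)
  qed simp
  also have "\<dots> = (\<Sum>i<m. vol i * b $ i) + \<alpha> * (\<Sum>i<m. vol i * (A *\<^sub>v u) $ i) +
      \<alpha> * (\<Sum>i<m. vol i * A $$ (i, i) * (u' $ i - u $ i))"
    by (simp add: sum.distrib sum_distrib_left)
  also have "(\<Sum>i<m. vol i * (A *\<^sub>v u) $ i) = 0"
    using sys jacobi_carrier[OF A b u0 inv] by (simp add: conservative_system_def u_def)
  finally show ?thesis by (simp add: u_def u'_def)
qed

lemma jacobi_mass_scalar_diag:
  assumes sys: "conservative_system m vol A b"
    and D: "diag_part A = a \<cdot>\<^sub>m 1\<^sub>m m" and \<alpha>a: "\<alpha> * a \<noteq> 1"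
    and u0: "u0 \<in> carrier_vec m" and mass0: "mass vol u0 = mass vol b"
  shows "mass vol (jacobi \<alpha> A b u0 k) = mass vol b"
proof (induction k)
  case 0
  show ?case using mass0 by simp
next
  case (Suc k)
  have A: "A \<in> carrier_mat m m" and b: "b \<in> carrier_vec m"
    using sys by (auto simp: conservative_system_def)
  have Aii: "A $$ (i, i) = a" if "i < m" for i
    using arg_cong[OF D, of "\<lambda>B. B $$ (i, i)"] that A by (simp add: diag_part_def)
  have inv: "invertible_mat (1\<^sub>m m - \<alpha> \<cdot>\<^sub>m diag_part A)"
    using A Aii \<alpha>a by (intro invertible_one_minus_diag_part) auto
  have mass_eq: "mass vol y = (\<Sum>i<m. vol i * y $ i)" if "y \<in> carrier_vec m" for y
    using that by (simp add: mass_def)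
  define u u' where "u = jacobi \<alpha> A b u0 k" and "u' = jacobi \<alpha> A b u0 (Suc k)"
  have u: "u \<in> carrier_vec m" and u': "u' \<in> carrier_vec m"
    unfolding u_def u'_def by (rule jacobi_carrier[OF A b u0 inv])+
  have "(\<Sum>i<m. vol i * A $$ (i, i) * (u' $ i - u $ i)) = a * (mass vol u' - mass vol u)"
    using Aii by (simp add: mass_eq u u' sum_distrib_left algebra_simps flip: sum_subtractf)
  then have "mass vol u' = mass vol b + \<alpha> * (a * (mass vol u' - mass vol u))"
    using jacobi_mass_defect[OF sys inv u0, of k, folded u_def u'_def] mass_eq[OF u'] mass_eq[OF b]
    by simp
  then have "(1 - \<alpha> * a) * (mass vol u' - mass vol b) = 0"
    using Suc.IH by (simp add: u_def algebra_simps)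
  then show ?case using \<alpha>a by (simp add: u'_def)
qed

text \<open>
  The witness is \<open>A = ((-1, 0), (1, 0))\<close> with unit volumes, \<open>\<alpha> = 1\<close>, \<open>b = 0\<close> and \<open>u0 = (1, -1)\<close>.
  Only the first diagonal entry is nonzero, and the first cell goes from 1 to 0 in one step, so
  the mass jumps from 0 to \<open>-1 * (0 - 1) = 1\<close>.
\<close>

lemma jacobi_not_conservative:
  obtains m vol \<alpha> A b u0 where
    "conservative_system m vol A b" "invertible_mat (1\<^sub>m m - \<alpha> \<cdot>\<^sub>m diag_part A)"
    "u0 \<in> carrier_vec m" "mass vol u0 = mass vol b"
    "mass vol (jacobi \<alpha> A b u0 1) \<noteq> mass vol b"
proof
  define A :: "real mat" where
    "A = mat 2 2 (\<lambda>(i, j). if j = 0 then if i = 0 then -1 else 1 else 0)"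
  define b u0 :: "real vec" where "b = 0\<^sub>v 2" and "u0 = vec 2 (\<lambda>i. if i = 0 then 1 else -1)"
  define vol :: "nat \<Rightarrow> real" where "vol = (\<lambda>_. 1)"
  have A: "A \<in> carrier_mat 2 2" and b: "b \<in> carrier_vec 2" and u0: "u0 \<in> carrier_vec 2"
    by (auto simp: A_def b_def u0_def)
  have two: "{..<2} = {0, 1 :: nat}" "{0..<2} = {0, 1 :: nat}" by auto
  show sys: "conservative_system 2 vol A b"
    using A b by (auto simp: conservative_system_def vol_def two A_def scalar_prod_def)
  show inv: "invertible_mat (1\<^sub>m 2 - 1 \<cdot>\<^sub>m diag_part A)"
    using A by (rule invertible_one_minus_diag_part) (auto simp: A_def)
  show "u0 \<in> carrier_vec 2" by (rule u0)
  show "mass vol u0 = mass vol b"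
    by (simp add: mass_def b_def u0_def vol_def two)
  define u1 where "u1 = jacobi 1 A b u0 1"
  have u1: "u1 \<in> carrier_vec 2"
    unfolding u1_def by (rule jacobi_carrier[OF A b u0 inv])
  have "(A *\<^sub>v u0) $ 0 = -1"
    by (simp add: A_def u0_def scalar_prod_def two)
  then have "u1 $ 0 = 0"
    using jacobi_Suc_index[OF A b u0 inv, of 0 0] by (simp add: u1_def A_def b_def u0_def)
  then have "(\<Sum>i<2. vol i * u1 $ i) = 1"
    using jacobi_mass_defect[OF sys inv u0, of 0]
    by (simp add: two vol_def A_def b_def u0_def u1_def)
  then show "mass vol (jacobi 1 A b u0 1) \<noteq> mass vol b"
    using u1 by (simp add: mass_def b_def u1_def)
qed

theorem mainTheorem8:
  shows "(\<forall>(m::nat) (vol::nat \<Rightarrow> real) (\<alpha>::real) (A::real mat) (b::real vec) (u0::real vec) (k::nat).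
            conservative_system m vol A b \<longrightarrow>
            invertible_mat (1\<^sub>m m - \<alpha> \<cdot>\<^sub>m diag_part A) \<longrightarrow>
            u0 \<in> carrier_vec m \<longrightarrow>
            (\<Sum>i<m. vol i * jacobi \<alpha> A b u0 (Suc k) $ i) =
              (\<Sum>i<m. vol i * b $ i) +
              \<alpha> * (\<Sum>i<m. vol i * A $$ (i, i) *
                     (jacobi \<alpha> A b u0 (Suc k) $ i - jacobi \<alpha> A b u0 k $ i)))
       \<and> (\<exists>(m::nat) (vol::nat \<Rightarrow> real) (\<alpha>::real) (A::real mat) (b::real vec).
            conservative_system m vol A b \<and>
            invertible_mat (1\<^sub>m m - \<alpha> \<cdot>\<^sub>m diag_part A) \<and>
            \<not> globally_conservative vol b (jacobi \<alpha> A b) \<and>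
            (\<exists>u0 \<in> carrier_vec m. mass vol u0 = mass vol b \<and>
               mass vol (jacobi \<alpha> A b u0 1) \<noteq> mass vol b))
       \<and> (\<forall>(m::nat) (vol::nat \<Rightarrow> real) (\<alpha>::real) (A::real mat) (b::real vec) (u0::real vec) (a::real).
            conservative_system m vol A b \<longrightarrow>
            diag_part A = a \<cdot>\<^sub>m 1\<^sub>m m \<longrightarrow> \<alpha> * a \<noteq> 1 \<longrightarrow>
            u0 \<in> carrier_vec m \<longrightarrow> mass vol u0 = mass vol b \<longrightarrow>
            (\<forall>k. mass vol (jacobi \<alpha> A b u0 (Suc k)) = mass vol b))"
proof (intro conjI)
  obtain m vol \<alpha> A b u0 where ex: "conservative_system m vol A b"
    "invertible_mat (1\<^sub>m m - \<alpha> \<cdot>\<^sub>m diag_part A)" "u0 \<in> carrier_vec m"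
    "mass vol u0 = mass vol b" "mass vol (jacobi \<alpha> A b u0 1) \<noteq> mass vol b"
    by (rule jacobi_not_conservative)
  then have "\<not> globally_conservative vol b (jacobi \<alpha> A b)"
    by (auto simp: globally_conservative_def conservative_system_def simp del: jacobi.simps)
  with ex show "\<exists>(m::nat) (vol::nat \<Rightarrow> real) (\<alpha>::real) (A::real mat) (b::real vec).
      conservative_system m vol A b \<and>
      invertible_mat (1\<^sub>m m - \<alpha> \<cdot>\<^sub>m diag_part A) \<and>
      \<not> globally_conservative vol b (jacobi \<alpha> A b) \<and>
      (\<exists>u0 \<in> carrier_vec m. mass vol u0 = mass vol b \<and>
         mass vol (jacobi \<alpha> A b u0 1) \<noteq> mass vol b)"
    by blast
qed (use jacobi_mass_defect jacobi_mass_scalar_diag in blast)+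

end
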